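(* Let $0 \leq \alpha \leq \frac{1}{6}$ be a fixed real number. Then every $n$-vertex graph $G=(V,E)$ with $m$ edges and no isolated vertices has a bipartition $V = V_1 \cup V_2$ into disjoint parts with $|V_1|, |V_2| \ge \left\lfloor \left(\frac12 - \alpha\right) n \right\rfloor$ (an $\alpha$-bisection) such that $$e(V_1,V_2) \ge \frac{m}{2} + \alpha n .$$
   Context: Graphs are finite and simple. $e(V_1,V_2)$ denotes the number of edges with one endpoint in $V_1$ and the other in $V_2$ (the size of the bipartition). An $\alpha$-bisection is a bipartition in which both sides have at least $(\frac12-\alpha)n$ vertices, up to rounding as made explicit in the claim. *)

theory Defs
  imports Complex_Main
begin

definition simple_graph :: "'a set \<Rightarrow> 'a set set \<Rightarrow> bool" where
  "simple_graph V E \<longleftrightarrow> finite V \<and> (\<forall>e\<in>E. e \<subseteq> V \<and> card e = 2)"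

definition no_isolated_vertices :: "'a set \<Rightarrow> 'a set set \<Rightarrow> bool" where
  "no_isolated_vertices V E \<longleftrightarrow> (\<forall>v\<in>V. \<exists>e\<in>E. v \<in> e)"

definition edges_between :: "'a set set \<Rightarrow> 'a set \<Rightarrow> 'a set \<Rightarrow> nat" where
  "edges_between E V1 V2 = card {e \<in> E. \<exists>u\<in>V1. \<exists>v\<in>V2. e = {u, v}}"

definition bipartition :: "'a set \<Rightarrow> 'a set \<Rightarrow> 'a set \<Rightarrow> bool" where
  "bipartition V V1 V2 \<longleftrightarrow> V1 \<union> V2 = V \<and> V1 \<inter> V2 = {}"

(* The floor is an integer, so the part sizes are compared in int. *)
definition alpha_bisection :: "real \<Rightarrow> 'a set \<Rightarrow> 'a set \<Rightarrow> 'a set \<Rightarrow> bool" where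
  "alpha_bisection \<alpha> V V1 V2 \<longleftrightarrow> bipartition V V1 V2 \<and>
     int (card V1) \<ge> \<lfloor>(1/2 - \<alpha>) * real (card V)\<rfloor> \<and>
     int (card V2) \<ge> \<lfloor>(1/2 - \<alpha>) * real (card V)\<rfloor>"

end

theory Submission
  imports Defs
begin

text \<open>
  Call twice the size of a cut minus the number of edges its surplus. If two disjoint vertex sets
  carry cuts, then one of the two ways of gluing these cuts together cuts at least half of the edges
  between the sets, so surpluses add up, and so do imbalances. An induced star with \<open>l\<close> leaves has
  a cut of surplus \<open>l\<close> and imbalance \<open>l - 1\<close>, and any set has a cut of nonnegative surplus and
  imbalance at most 1. It remains to find disjoint induced stars with
  \<open>\<lceil>2 \<alpha> n\<rceil>\<close> leaves in total. In a packing with the maximum number of leaves, every uncovered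
  vertex is adjacent to a leaf and every leaf is adjacent to at most one uncovered vertex. So there
  are at most as many uncovered vertices as leaves; the same holds for the centers, and at least
  \<open>n / 3\<close> vertices are leaves. Excess leaves can be dropped.
\<close>

section \<open>Counting edges inside and between vertex sets\<close>

lemma simple_graph_finite_edges:
  assumes "simple_graph V E"
  shows "finite E"
proof (rule finite_subset)
  show "E \<subseteq> Pow V" "finite (Pow V)"
    using assms by (auto simp: simple_graph_def)
qed

lemma simple_graph_edge_neq:
  assumes "simple_graph V E" "{u, v} \<in> E"
  shows "u \<noteq> v"
  using assms by (auto simp: simple_graph_def)

lemma edges_between_commute: "edges_between E A B = edges_between E B A"
proof -
  have "{e \<in> E. \<exists>u\<in>A. \<exists>v\<in>B. e = {u, v}} = {e \<in> E. \<exists>u\<in>B. \<exists>v\<in>A. e = {u, v}}"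
    by (metis insert_commute)
  then show ?thesis
    by (simp add: edges_between_def)
qed

lemma edges_between_Un_left:
  assumes "finite E" "A \<inter> B = {}" "A \<inter> C = {}" "B \<inter> C = {}"
  shows "edges_between E (A \<union> B) C = edges_between E A C + edges_between E B C"
proof -
  have "{e \<in> E. \<exists>u\<in>A \<union> B. \<exists>v\<in>C. e = {u, v}} =
      {e \<in> E. \<exists>u\<in>A. \<exists>v\<in>C. e = {u, v}} \<union> {e \<in> E. \<exists>u\<in>B. \<exists>v\<in>C. e = {u, v}}"
    by blast
  moreover have "{e \<in> E. \<exists>u\<in>A. \<exists>v\<in>C. e = {u, v}} \<inter> {e \<in> E. \<exists>u\<in>B. \<exists>v\<in>C. e = {u, v}} = {}"
    using assms(2-4) by (auto simp: doubleton_eq_iff)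
  ultimately show ?thesis
    using assms(1) by (simp add: edges_between_def card_Un_disjoint)
qed

lemma edges_between_Un_right:
  assumes "finite E" "B \<inter> C = {}" "A \<inter> B = {}" "A \<inter> C = {}"
  shows "edges_between E A (B \<union> C) = edges_between E A B + edges_between E A C"
  using edges_between_Un_left[of E B C A] assms
  by (simp add: edges_between_commute[of E A] Int_commute)

definition edges_inside :: "'a set set \<Rightarrow> 'a set \<Rightarrow> nat" where
  "edges_inside E S = card {e \<in> E. e \<subseteq> S}"

lemma edges_inside_Un:
  assumes "simple_graph V E" "S \<inter> T = {}"
  shows "edges_inside E (S \<union> T) = edges_inside E S + edges_inside E T + edges_between E S T"
proof -
  have fin: "finite E"
    using assms(1) by (rule simple_graph_finite_edges)
  let ?IS = "{e \<in> E. e \<subseteq> S}" and ?IT = "{e \<in> E. e \<subseteq> T}"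
  let ?B = "{e \<in> E. \<exists>u\<in>S. \<exists>v\<in>T. e = {u, v}}"
  have "{e \<in> E. e \<subseteq> S \<union> T} = (?IS \<union> ?IT) \<union> ?B"
  proof (intro equalityI subsetI)
    fix e assume e: "e \<in> {e \<in> E. e \<subseteq> S \<union> T}"
    then obtain x y where "e = {x, y}"
      using assms(1) by (auto simp: simple_graph_def card_2_iff)
    with e show "e \<in> (?IS \<union> ?IT) \<union> ?B"
      by (auto simp: doubleton_eq_iff)
  qed auto
  moreover have "?IS \<inter> ?IT = {}"
  proof -
    have "\<not> (e \<subseteq> S \<and> e \<subseteq> T)" if "e \<in> E" for e
      using that assms le_inf_iff[of e S T] by (auto simp: simple_graph_def)
    then show ?thesis
      by auto
  qed
  moreover have "(?IS \<union> ?IT) \<inter> ?B = {}"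
    using assms(2) by auto
  ultimately show ?thesis
    using fin by (simp add: edges_inside_def edges_between_def card_Un_disjoint)
qed

section \<open>Cuts with prescribed surplus and imbalance\<close>

text \<open>Here \<open>g\<close> is a lower bound for the surplus and \<open>d\<close> an upper
  bound for the imbalance. Writing \<open>g\<close> additively avoids truncated subtraction, and
  since neither bound has to be attained, both simply add under gluing.\<close>

definition has_cut :: "'a set set \<Rightarrow> 'a set \<Rightarrow> nat \<Rightarrow> nat \<Rightarrow> bool" where
  "has_cut E S g d \<longleftrightarrow> (\<exists>X Y. bipartition S X Y \<and>
     edges_inside E S + g \<le> 2 * edges_between E X Y \<and>
     card X \<le> card Y + d \<and> card Y \<le> card X + d)"

lemma has_cut_Un:
  assumes G: "simple_graph V E" and fin: "finite S" "finite T" and disj: "S \<inter> T = {}"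
    and S: "has_cut E S g d" and T: "has_cut E T g' d'"
  shows "has_cut E (S \<union> T) (g + g') (d + d')"
proof -
  have finE: "finite E"
    using G by (rule simple_graph_finite_edges)
  obtain X Y where XY: "X \<union> Y = S" "X \<inter> Y = {}"
      "edges_inside E S + g \<le> 2 * edges_between E X Y"
      "card X \<le> card Y + d" "card Y \<le> card X + d"
    using S by (auto simp: has_cut_def bipartition_def)
  obtain P Q where PQ: "P \<union> Q = T" "P \<inter> Q = {}"
      "edges_inside E T + g' \<le> 2 * edges_between E P Q"
      "card P \<le> card Q + d'" "card Q \<le> card P + d'"
    using T by (auto simp: has_cut_def bipartition_def)
  have d: "X \<inter> P = {}" "X \<inter> Q = {}" "Y \<inter> P = {}" "Y \<inter> Q = {}"
    using disj XY(1) PQ(1) by auto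
  have f: "finite X" "finite Y" "finite P" "finite Q"
    using fin XY(1) PQ(1) by auto
  have d': "X \<inter> P = {}" "X \<inter> Q = {}" "Y \<inter> P = {}" "Y \<inter> Q = {}" "X \<inter> Y = {}" "P \<inter> Q = {}"
      "P \<inter> X = {}" "Q \<inter> X = {}" "P \<inter> Y = {}" "Q \<inter> Y = {}" "Y \<inter> X = {}" "Q \<inter> P = {}"
    using d XY(2) PQ(2) by auto
  note add = edges_between_Un_left[OF finE] edges_between_Un_right[OF finE] Int_Un_distrib
    Int_Un_distrib2 d'
  have st: "edges_between E S T = edges_between E X P + edges_between E X Q
      + edges_between E Y P + edges_between E Y Q"
    unfolding XY(1)[symmetric] PQ(1)[symmetric] by (simp add: add)
  have c1: "edges_between E (X \<union> P) (Y \<union> Q) = edges_between E X Y + edges_between E X Q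
      + edges_between E Y P + edges_between E P Q"
    by (simp add: add edges_between_commute[of E P Y])
  have c2: "edges_between E (X \<union> Q) (Y \<union> P) = edges_between E X Y + edges_between E X P
      + edges_between E Y Q + edges_between E P Q"
    by (simp add: add edges_between_commute[of E Q])
  note ins = edges_inside_Un[OF G disj]
  have cards: "card (X \<union> P) = card X + card P" "card (Y \<union> Q) = card Y + card Q"
      "card (X \<union> Q) = card X + card Q" "card (Y \<union> P) = card Y + card P"
    using f d by (auto intro!: card_Un_disjoint)
  \<comment> \<open>Every edge between \<open>S\<close> and \<open>T\<close> is cut by exactly one
    of the two gluings. The two bracketed sums add up to \<open>edges_between E S T\<close>, so one
    of them is at least half of it.\<close>
  consider "edges_between E S T \<le> 2 * (edges_between E X Q + edges_between E Y P)"
    | "edges_between E S T \<le> 2 * (edges_between E X P + edges_between E Y Q)"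
    using st by fastforce
  then show ?thesis
  proof cases
    case 1
    have "bipartition (S \<union> T) (X \<union> P) (Y \<union> Q)"
      using XY(1) PQ(1) d' by (auto simp: bipartition_def)
    moreover have "edges_inside E (S \<union> T) + (g + g') \<le> 2 * edges_between E (X \<union> P) (Y \<union> Q)"
      using 1 ins c1 XY(3) PQ(3) by simp
    ultimately show ?thesis
      unfolding has_cut_def using cards XY(4,5) PQ(4,5)
      by (intro exI[of _ "X \<union> P"] exI[of _ "Y \<union> Q"]) simp
  next
    case 2
    have "bipartition (S \<union> T) (X \<union> Q) (Y \<union> P)"
      using XY(1) PQ(1) d' by (auto simp: bipartition_def)
    moreover have "edges_inside E (S \<union> T) + (g + g') \<le> 2 * edges_between E (X \<union> Q) (Y \<union> P)"
      using 2 ins c2 XY(3) PQ(3) by simp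
    ultimately show ?thesis
      unfolding has_cut_def using cards XY(4,5) PQ(4,5)
      by (intro exI[of _ "X \<union> Q"] exI[of _ "Y \<union> P"]) simp
  qed
qed

lemma edges_inside_card_le_1:
  assumes "simple_graph V E" "finite S" "card S \<le> 1"
  shows "edges_inside E S = 0"
proof -
  have "\<not> e \<subseteq> S" if "e \<in> E" for e
    using that assms card_mono[of S e] by (fastforce simp: simple_graph_def)
  then have "{e \<in> E. e \<subseteq> S} = {}"
    by auto
  then show ?thesis
    by (simp add: edges_inside_def del: Collect_empty_eq)
qed

lemma has_cut_pair:
  assumes G: "simple_graph V E" and "u \<noteq> v"
  shows "has_cut E {u, v} 0 0"
proof -
  have "edges_inside E ({u} \<union> {v}) = edges_between E {u} {v}"
    using edges_inside_Un[OF G, of "{u}" "{v}"] edges_inside_card_le_1[OF G] assms(2) by simp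
  then show ?thesis
    unfolding has_cut_def bipartition_def using assms(2)
    by (intro exI[of _ "{u}"] exI[of _ "{v}"]) (auto simp: insert_commute)
qed

text \<open>Pairs of vertices are split off one at a time, each adding no imbalance; the at most one
  remaining vertex accounts for the 1.\<close>

lemma has_cut_balanced:
  assumes G: "simple_graph V E" and "finite S"
  shows "has_cut E S 0 1"
  using assms(2)
proof (induction S rule: finite_psubset_induct)
  case (psubset S)
  show ?case
  proof (cases "card S \<le> 1")
    case True
    then show ?thesis
      unfolding has_cut_def bipartition_def
      using edges_inside_card_le_1[OF G psubset.hyps True]
      by (intro exI[of _ S] exI[of _ "{}"]) auto
  next
    case False
    then obtain u v where uv: "u \<in> S" "v \<in> S" "u \<noteq> v"
      using psubset.hyps by (metis card_le_Suc0_iff_eq One_nat_def)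
    have "has_cut E (S - {u, v}) 0 1"
      using uv by (intro psubset.IH) auto
    then have "has_cut E ((S - {u, v}) \<union> {u, v}) (0 + 0) (1 + 0)"
      using psubset.hyps uv(3) by (intro has_cut_Un[OF G] has_cut_pair[OF G]) auto
    moreover have "(S - {u, v}) \<union> {u, v} = S"
      using uv by auto
    ultimately show ?thesis
      by simp
  qed
qed

text \<open>The center against the leaves cuts all \<open>card N\<close> edges of the star, so twice
  the cut exceeds the edge count by \<open>card N\<close>. As \<open>N\<close> is nonempty, the
  difference \<open>card N - 1\<close> is not truncated.\<close>

lemma has_cut_star:
  assumes G: "simple_graph V E" and N: "finite N" "N \<noteq> {}"
    and adj: "\<And>v. v \<in> N \<Longrightarrow> {c, v} \<in> E"
    and indep: "\<And>u v. u \<in> N \<Longrightarrow> v \<in> N \<Longrightarrow> {u, v} \<notin> E"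
  shows "has_cut E (insert c N) (card N) (card N - 1)"
proof -
  have cN: "c \<notin> N"
    using adj simple_graph_edge_neq[OF G] by blast
  have "{e \<in> E. \<exists>u\<in>{c}. \<exists>v\<in>N. e = {u, v}} = (\<lambda>v. {c, v}) ` N"
    using adj by auto
  moreover have "inj_on (\<lambda>v. {c, v}) N"
    by (auto simp: inj_on_def doubleton_eq_iff)
  ultimately have star: "edges_between E {c} N = card N"
    by (simp add: edges_between_def card_image)
  have "{e \<in> E. e \<subseteq> N} = {}"
  proof -
    have "\<not> e \<subseteq> N" if e: "e \<in> E" for e
    proof -
      obtain x y where "e = {x, y}"
        using G e by (auto simp: simple_graph_def card_2_iff)
      then show ?thesis
        using indep e by auto
    qed
    then show ?thesis
      by auto
  qed
  then have "edges_inside E N = 0"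
    by (simp add: edges_inside_def del: Collect_empty_eq)
  then have "edges_inside E ({c} \<union> N) = card N"
    using edges_inside_Un[OF G, of "{c}" N] edges_inside_card_le_1[OF G, of "{c}"] star cN by simp
  moreover have "card N \<ge> 1"
    using N by (simp add: Suc_le_eq card_gt_0_iff)
  ultimately show ?thesis
    unfolding has_cut_def bipartition_def using star cN
    by (intro exI[of _ "{c}"] exI[of _ N]) auto
qed

text \<open>A packing of disjoint induced stars is encoded by its set \<open>A\<close> of leaves and the function
  \<open>f\<close> sending each leaf to the center of its star. The centers are thus \<open>f ` A\<close>, and every star
  has at least one leaf.\<close>

definition star_packing :: "'a set \<Rightarrow> 'a set set \<Rightarrow> 'a set \<Rightarrow> ('a \<Rightarrow> 'a) \<Rightarrow> bool" where
  "star_packing V E A f \<longleftrightarrow> A \<subseteq> V \<and>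
     (\<forall>a\<in>A. f a \<in> V - A \<and> {f a, a} \<in> E) \<and>
     (\<forall>a\<in>A. \<forall>b\<in>A. f a = f b \<longrightarrow> {a, b} \<notin> E)"

lemma star_packing_subset:
  assumes "star_packing V E A f" "B \<subseteq> A"
  shows "star_packing V E B f"
  using assms unfolding star_packing_def by blast

lemma has_cut_star_packing:
  assumes G: "simple_graph V E" and A: "star_packing V E A f"
  shows "has_cut E (A \<union> f ` A) (card A) (card A - card (f ` A))"
proof -
  have finA: "finite A"
    using A G by (auto simp: star_packing_def simple_graph_def intro: finite_subset)
  define L where "L c = {a \<in> A. f a = c}" for c
  have finL: "finite (L c)" for c
    using finA by (simp add: L_def)
  \<comment> \<open>The stars are glued one center at a time. They are disjoint because leaves with
    different centers differ and no center is a leaf.\<close>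
  have *: "has_cut E (\<Union>c\<in>C. insert c (L c)) (\<Sum>c\<in>C. card (L c)) (\<Sum>c\<in>C. card (L c) - 1)"
    if "finite C" "C \<subseteq> f ` A" for C
    using that
  proof (induction C rule: finite_induct)
    case empty
    have "edges_inside E {} = 0"
      by (intro edges_inside_card_le_1[OF G]) auto
    then show ?case
      by (simp add: has_cut_def bipartition_def)
  next
    case (insert c C)
    have "has_cut E (insert c (L c)) (card (L c)) (card (L c) - 1)"
      using A insert.prems by (intro has_cut_star[OF G finL]) (auto simp: L_def star_packing_def)
    moreover have "(insert c (L c)) \<inter> (\<Union>c\<in>C. insert c (L c)) = {}"
      using A insert.prems insert.hyps by (auto simp: L_def star_packing_def)
    ultimately show ?case
      using has_cut_Un[OF G, of "insert c (L c)" "\<Union>c\<in>C. insert c (L c)"] insert finL by simp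
  qed
  have "(\<Union>c\<in>f ` A. insert c (L c)) = A \<union> f ` A"
    by (auto simp: L_def)
  moreover have sum: "(\<Sum>c\<in>f ` A. card (L c)) = card A"
    using sum.image_gen[OF finA, of "\<lambda>_. 1::nat" f] by (simp add: L_def)
  moreover have "(\<Sum>c\<in>f ` A. card (L c) - 1) = card A - card (f ` A)"
  proof -
    \<comment> \<open>Each \<open>L c\<close> is nonempty for \<open>c\<close> in the image of
      \<open>f\<close>, so subtraction commutes with the sum.\<close>
    have "(\<Sum>c\<in>f ` A. card (L c) - 1) = (\<Sum>c\<in>f ` A. card (L c)) - (\<Sum>c\<in>f ` A. 1)"
      using finL by (intro sum_subtractf_nat) (auto simp: L_def Suc_le_eq card_gt_0_iff)
    then show ?thesis
      using sum by simp
  qed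
  ultimately show ?thesis
    using *[of "f ` A"] finA by simp
qed

section \<open>A packing whose leaves are a third of the vertices\<close>

lemma star_packing_large:
  assumes G: "simple_graph V E" and iso: "no_isolated_vertices V E"
  obtains A f where "star_packing V E A f" "card V \<le> 3 * card A"
proof -
  have finV: "finite V"
    using G by (simp add: simple_graph_def)
  let ?P = "\<lambda>A. \<exists>f. star_packing V E A f"
  have "?P {}"
    by (simp add: star_packing_def)
  moreover have "\<forall>A. ?P A \<longrightarrow> card A < Suc (card V)"
    using finV by (auto simp: star_packing_def less_Suc_eq_le intro: card_mono)
  ultimately obtain A where "?P A" "\<forall>B. ?P B \<longrightarrow> card B \<le> card A"
    using ex_has_greatest_nat[of ?P "{}" card "Suc (card V)"] by blast
  then obtain f where A: "star_packing V E A f"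
    and max: "\<And>B h. star_packing V E B h \<Longrightarrow> card B \<le> card A"
    by blast
  have AV: "A \<subseteq> V" "f ` A \<subseteq> V"
    using A by (auto simp: star_packing_def)
  have finA: "finite A"
    using AV finV finite_subset by blast
  define U where "U = V - A - f ` A"
  have U: "u \<in> V" "u \<notin> A" "u \<notin> f ` A" if "u \<in> U" for u
    using that by (auto simp: U_def)
  \<comment> \<open>The independence condition of \<open>star_packing\<close> includes the case of
    equal leaves, where it asks that there be no loop.\<close>
  have nl: "{x} \<notin> E" for x
    using G by (auto simp: simple_graph_def)
  have indep: "{u, v} \<notin> E" if uv: "u \<in> U" "v \<in> U" for u v
  proof
    assume e: "{u, v} \<in> E"
    then have "u \<noteq> v"
      using nl by auto
    \<comment> \<open>The edge itself would be a new star with leaf \<open>u\<close> and center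
      \<open>v\<close>.\<close>
    then have "star_packing V E (insert u A) (f(u := v))"
      using A U[OF uv(1)] U[OF uv(2)] e nl
      by (auto simp: star_packing_def insert_commute)
    then show False
      using max[of "insert u A"] U(2)[OF uv(1)] finA by fastforce
  qed
  have leaf_nbr: "\<exists>a\<in>A. {u, a} \<in> E" if u: "u \<in> U" for u
  proof (rule ccontr)
    assume no: "\<not> ?thesis"
    obtain e where e: "e \<in> E" "u \<in> e"
      using iso U(1)[OF u] by (auto simp: no_isolated_vertices_def)
    then obtain x y where "e = {x, y}"
      using G by (auto simp: simple_graph_def card_2_iff)
    then obtain v where v: "{u, v} \<in> E"
      using e by (auto simp: insert_commute)
    then have "v \<in> V"
      using G by (auto simp: simple_graph_def)
    then have vc: "v \<in> f ` A"
      using no v indep u by (auto simp: U_def)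
    \<comment> \<open>The neighbor \<open>v\<close> is a center, and \<open>u\<close> is adjacent to
      no leaf, so \<open>u\<close> can join the star of \<open>v\<close>.\<close>
    have "star_packing V E (insert u A) (f(u := v))"
      using A U[OF u] vc v no nl
      by (auto simp: star_packing_def insert_commute)
    then show False
      using max[of "insert u A"] U(2)[OF u] finA by fastforce
  qed
  have leaf_uniq: "u = v" if uv: "u \<in> U" "v \<in> U" and a: "a \<in> A" "{u, a} \<in> E" "{v, a} \<in> E" for u v a
  proof (rule ccontr)
    assume "u \<noteq> v"
    let ?B = "insert u (insert v (A - {a}))"
    \<comment> \<open>Leaf \<open>a\<close> leaves its star and becomes the center of a new one with
      leaves \<open>u\<close> and \<open>v\<close>, which are nonadjacent by \<open>indep\<close>: a
      net gain of one leaf. If \<open>a\<close> was the only leaf of its star, the old center just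
      becomes uncovered.\<close>
    have "star_packing V E ?B (f(u := a, v := a))"
      using A U[OF uv(1)] U[OF uv(2)] a nl indep uv
      by (auto simp: star_packing_def insert_commute)
    then have "card ?B \<le> card A"
      by (rule max)
    moreover have "card ?B = Suc (Suc (card A - 1))"
      using U(2)[OF uv(1)] U(2)[OF uv(2)] \<open>u \<noteq> v\<close> finA a(1) by simp
    ultimately show False
      by simp
  qed
  \<comment> \<open>Choosing a leaf neighbor for each uncovered vertex is injective by
    \<open>leaf_uniq\<close>.\<close>
  obtain l where l: "\<And>u. u \<in> U \<Longrightarrow> l u \<in> A \<and> {u, l u} \<in> E"
    using leaf_nbr by metis
  have "card U \<le> card A"
    using l leaf_uniq finA by (intro card_inj_on_le[of l]) (auto simp: inj_on_def, metis)
  moreover have "card (f ` A) \<le> card A"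
    using finA by (rule card_image_le)
  moreover have "card V \<le> card A + card (f ` A) + card U"
  proof -
    have "V = (A \<union> f ` A) \<union> U"
      using AV by (auto simp: U_def)
    then show ?thesis
      by (metis card_Un_le add_le_mono1 le_trans)
  qed
  ultimately have "card V \<le> 3 * card A"
    by linarith
  with A show ?thesis
    by (rule that)
qed

section \<open>From star packings to bisections\<close>

text \<open>The hypothesis on \<open>k\<close> says that \<open>k\<close> is at most a third of
  \<open>card V\<close> rounded up, which is the number of leaves that can be guaranteed.\<close>

lemma has_cut_of_no_isolated_vertices:
  assumes G: "simple_graph V E" and iso: "no_isolated_vertices V E" and k: "3 * k \<le> card V + 2"
  shows "has_cut E V k (max k 1)"
proof -
  obtain A f where A: "star_packing V E A f" "card V \<le> 3 * card A"
    using star_packing_large[OF G iso] .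
  then have "k \<le> card A"
    using k by linarith
  then obtain B where B: "B \<subseteq> A" "card B = k" "finite B"
    by (rule obtain_subset_with_card_n)
  have pack: "star_packing V E B f"
    using A(1) B(1) by (rule star_packing_subset)
  have finV: "finite V"
    using G by (simp add: simple_graph_def)
  let ?S = "B \<union> f ` B"
  have S: "?S \<subseteq> V"
    using pack by (auto simp: star_packing_def)
  have "has_cut E (?S \<union> (V - ?S)) (k + 0) (k - card (f ` B) + 1)"
    using has_cut_star_packing[OF G pack] B finV
    by (intro has_cut_Un[OF G] has_cut_balanced[OF G]) auto
  then have "has_cut E V k (k - card (f ` B) + 1)"
    using S by (simp add: Un_absorb1)
  \<comment> \<open>The uncovered rest costs imbalance 1, which the first center pays for. Only for
    \<open>k = 0\<close> is there no center, hence the maximum with 1.\<close>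
  moreover have "k - card (f ` B) + 1 \<le> max k 1"
  proof (cases "B = {}")
    case False
    then have "card (f ` B) \<ge> 1"
      using B(3) by (simp add: Suc_le_eq card_gt_0_iff)
    then show ?thesis
      by linarith
  qed (use B in auto)
  ultimately show ?thesis
    unfolding has_cut_def by (meson add_le_mono le_trans order_refl)
qed

theorem theorem1p6:
  fixes \<alpha> :: real and V :: "'a set" and E :: "'a set set" and n m :: nat
  assumes "0 \<le> \<alpha>" and "\<alpha> \<le> 1/6"
    and "simple_graph V E"
    and "card V = n" and "card E = m"
    and "no_isolated_vertices V E"
  shows "\<exists>V1 V2. alpha_bisection \<alpha> V V1 V2 \<and>
           real (edges_between E V1 V2) \<ge> real m / 2 + \<alpha> * real n"
proof -
  \<comment> \<open>Surplus \<open>k\<close> puts the cut at \<open>(m + k) / 2\<close> or more, so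
    this is the least integer that suffices.\<close>
  define k where "k = nat \<lceil>2 * \<alpha> * real n\<rceil>"
  have "0 \<le> 2 * \<alpha> * real n"
    using assms(1) by simp
  then have k: "2 * \<alpha> * real n \<le> real k" "real k < 2 * \<alpha> * real n + 1"
    unfolding k_def by linarith+
  have "2 * \<alpha> * real n \<le> real n / 3"
    using mult_right_mono[OF assms(2), of "real n"] by simp
  \<comment> \<open>From \<open>k < n / 3 + 1\<close> comes \<open>3 * k < n + 3\<close>, and both
    sides are integers.\<close>
  with k have "3 * k \<le> card V + 2"
    using assms(4) by linarith
  then obtain X Y where XY: "bipartition V X Y"
      "edges_inside E V + k \<le> 2 * edges_between E X Y"
      "card X \<le> card Y + max k 1" "card Y \<le> card X + max k 1"
    using has_cut_of_no_isolated_vertices[OF assms(3,6)] unfolding has_cut_def by blast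
  have "{e \<in> E. e \<subseteq> V} = E"
    using assms(3) by (auto simp: simple_graph_def)
  then have "edges_inside E V = m"
    using assms(5) by (simp add: edges_inside_def)
  then have "real m + real k \<le> 2 * real (edges_between E X Y)"
    using XY(2) by linarith
  then have cut: "real m / 2 + \<alpha> * real n \<le> real (edges_between E X Y)"
    using k(1) by simp
  have "finite V"
    using assms(3) by (simp add: simple_graph_def)
  then have n: "n = card X + card Y"
    using XY(1) assms(4) by (metis bipartition_def card_Un_disjoint finite_Un)
  define s where "s = \<lfloor>(1/2 - \<alpha>) * real n\<rfloor>"
  have "real_of_int s \<le> real n / 2 - \<alpha> * real n"
    using of_int_floor_le[of "(1/2 - \<alpha>) * real n"] by (simp add: s_def left_diff_distrib)
  then have "real_of_int (2 * s) < real n + 1 - real k" "real_of_int (2 * s) \<le> real n"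
    using k(2) \<open>0 \<le> 2 * \<alpha> * real n\<close> by auto
  \<comment> \<open>Integrality turns the strict bound by \<open>n + 1 - k\<close> into a bound by
    \<open>n - k\<close>.\<close>
  then have "2 * s \<le> int n - int k" "2 * s \<le> int n"
    by linarith+
  \<comment> \<open>Each side has at least \<open>(n - max k 1) / 2\<close> vertices. For
    \<open>k \<ge> 1\<close> this is at least \<open>s\<close>; for \<open>k = 0\<close> it is at
    least \<open>s - 1/2\<close>, and rounding up to an integer gives \<open>s\<close>.\<close>
  then have "s \<le> int (card X)" "s \<le> int (card Y)"
    using XY(3,4) n by linarith+
  then have "alpha_bisection \<alpha> V X Y"
    using XY(1) assms(4) by (simp add: alpha_bisection_def s_def)
  with cut show ?thesis
    by blast
qed

end
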